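(* Let $\psi:[0,1]\to[0,1]$ be a convex, strictly increasing, surjective, three times differentiable function with $\psi'>0$ on $(0,1]$, such that (1) $x\mapsto x\,\psi'(x)/\psi(x)$ is strictly increasing on $(0,1]$; (2) $x\mapsto x\,\psi''(x)/\psi'(x)$ is strictly increasing on $(0,1]$; (3) $\psi(e^{-r/e})+\psi(r e^{-r/e})\ge 1$ for all $0\le r\le 1$. Then for every $n\ge1$ and every $n\times n$ matrix $B$ with nonnegative entries and rows $b_1,\dots,b_n$, \[ \operatorname{Per}(B)\le\prod_{i=1}^n\|b_i\|_\psi . \]
   Context: For $\psi:[0,1]\to[0,1]$ a continuous strictly increasing bijection (so $\psi(0)=0,\psi(1)=1$) and a vector $v\in\mathbb R^k$ (any $k$), the Orlicz norm $\|v\|_\psi$ is $0$ if $v=0$, and otherwise the unique $s>0$ with $\sum_{i=1}^k\psi(|v_i|/s)=1$. $\operatorname{Per}$ denotes the permanent. *)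

theory Defs
  imports "HOL-Analysis.Analysis"
begin

text \<open>Orlicz norm of a vector v of length n (entries v 0, ..., v (n-1)):
  0 if v = 0, otherwise the unique s > 0 with sum psi(|v i|/s) = 1
  (where all arguments |v i|/s lie in the domain [0,1] of psi).\<close>
definition orlicz_norm :: "(real \<Rightarrow> real) \<Rightarrow> nat \<Rightarrow> (nat \<Rightarrow> real) \<Rightarrow> real" where
  "orlicz_norm \<psi> n v =
     (if (\<forall>i<n. v i = 0) then 0
      else (THE s. s > 0 \<and> (\<forall>i<n. \<bar>v i\<bar> \<le> s) \<and> (\<Sum>i<n. \<psi> (\<bar>v i\<bar> / s)) = 1))"

definition per :: "nat \<Rightarrow> (nat \<Rightarrow> nat \<Rightarrow> real) \<Rightarrow> real" where
  "per n B = (\<Sum>\<sigma> | \<sigma> permutes {..<n}. \<Prod>i<n. B i (\<sigma> i))"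

end

theory Submission
  imports Defs
begin

text \<open>After rescaling the rows one has to show that the permanent is at most 1 when every row
  satisfies \<open>\<Sum>\<^sub>j \<psi> (b\<^sub>i\<^sub>j) \<le> 1\<close>; this goes by induction on the size. Let \<open>g\<^sub>i\<close> be defined by
  \<open>\<psi> (x\<^sub>i) + \<psi> (g\<^sub>i) = 1\<close>, where \<open>x\<^sub>i\<close> is the entry of row \<open>i\<close> in a chosen column. Condition (1) makes
  \<open>\<psi>\<close> supermultiplicative, so deleting that entry leaves a row of Orlicz norm at most \<open>g\<^sub>i\<close>, and
  Laplace expansion bounds the permanent by \<open>\<Sum>\<^sub>i x\<^sub>i \<Prod>\<^sub>k\<^sub>\<noteq>\<^sub>i g\<^sub>k\<close>. Condition (3) says
  \<open>x \<le> e g ln (1/g)\<close>. Each row has at most one entry with \<open>\<psi> > 1/2\<close>, so some column has at most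
  one such entry, \<open>x\<^sub>0\<close> say; with \<open>U = \<Sum>\<^sub>i\<^sub>\<noteq>\<^sub>0 ln (1/g\<^sub>i)\<close> the bound for that column becomes
  \<open>(x\<^sub>0 + e g\<^sub>0 U) exp (-U)\<close>, which is at most 1.\<close>

section \<open>An exponential inequality\<close>

text \<open>The left side is convex on [0,1] and vanishes at 0, so it lies below its chord, of slope
  e - 1/e. At t = ln r the weakened bound becomes r - 1/r <= e ln r.\<close>

lemma sinh_chord:
  fixes t :: real
  assumes "0 \<le> t" "t \<le> 1"
  shows "exp t - exp (- t) \<le> exp 1 * t"
proof -
  have conv: "convex_on {0..1} (\<lambda>t::real. exp t - exp (- t))"
  proof (rule f''_ge0_imp_convex)
    fix x :: real
    show "((\<lambda>t. exp t - exp (- t)) has_real_derivative exp x + exp (- x)) (at x)"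
      by (auto intro!: derivative_eq_intros)
    show "((\<lambda>x. exp x + exp (- x)) has_real_derivative exp x - exp (- x)) (at x)"
      by (auto intro!: derivative_eq_intros)
    show "x \<in> {0..1} \<Longrightarrow> 0 \<le> exp x - exp (- x)" by simp
  qed simp
  have "exp ((1 - t) *\<^sub>R 0 + t *\<^sub>R 1) - exp (- ((1 - t) *\<^sub>R 0 + t *\<^sub>R 1))
      \<le> (1 - t) * (exp 0 - exp (- 0)) + t * (exp 1 - exp (- (1::real)))"
    by (rule convex_onD[OF conv]) (use assms in auto)
  moreover have "t * (exp 1 - exp (- (1::real))) \<le> t * exp 1"
    using assms by (intro mult_left_mono) auto
  ultimately show ?thesis by (simp add: mult.commute)
qed

section \<open>Permanents over finite index sets\<close>

text \<open>The bijections run from columns to rows, because the expansion is along a column; \<open>B\<close> still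
  takes the row index first.\<close>
definition perm_on :: "'a set \<Rightarrow> 'b set \<Rightarrow> ('b \<Rightarrow> 'a \<Rightarrow> real) \<Rightarrow> real" where
  "perm_on C R B = (\<Sum>f | f \<in> extensional C \<and> bij_betw f C R. \<Prod>j\<in>C. B (f j) j)"

lemma perm_on_empty [simp]: "perm_on {} {} B = 1"
proof -
  have "{f. f \<in> extensional {} \<and> bij_betw f {} {}} = {\<lambda>x. undefined}"
    by (auto simp: bij_betw_def)
  then show ?thesis unfolding perm_on_def prod.empty by (metis sum.empty sum.insert empty_iff finite.emptyI add_0_right)
qed

lemma finite_ext_bij:
  assumes "finite C" "finite R"
  shows "finite {f. f \<in> extensional C \<and> bij_betw f C R}"
  by (rule finite_subset[OF _ finite_PiE[of C "\<lambda>_. R"]])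
     (use assms in \<open>auto simp: PiE_def bij_betw_def\<close>)

text \<open>Laplace expansion along column \<open>c\<close>: a bijection amounts to its value
  \<open>i\<close> at \<open>c\<close> together with its restriction to \<open>C\<close>.
  Extensionality makes this correspondence exact.\<close>

lemma perm_on_insert:
  assumes "finite C" "finite R" "c \<notin> C"
  shows "perm_on (insert c C) R B = (\<Sum>i\<in>R. B i c * perm_on C (R - {i}) B)"
proof -
  let ?F = "\<lambda>C R. {f. f \<in> extensional C \<and> bij_betw f C R}"
  have "(\<Sum>i\<in>R. B i c * perm_on C (R - {i}) B)
      = (\<Sum>(i, f)\<in>Sigma R (\<lambda>i. ?F C (R - {i})). B i c * (\<Prod>j\<in>C. B (f j) j))"
    unfolding perm_on_def sum_distrib_left
    by (rule sum.Sigma) (use assms in \<open>auto simp del: mem_Collect_eq intro!: finite_ext_bij\<close>)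
  also have "\<dots> = perm_on (insert c C) R B"
    unfolding perm_on_def
  proof (rule sum.reindex_bij_witness[where i = "\<lambda>f. (f c, restrict f C)"
        and j = "\<lambda>(i, f). f(c := i)"])
    fix p assume "p \<in> Sigma R (\<lambda>i. ?F C (R - {i}))"
    then obtain i f where p: "p = (i, f)" "i \<in> R" "f \<in> extensional C" "bij_betw f C (R - {i})"
      by auto
    show "((case p of (i, f) \<Rightarrow> f(c := i)) c, restrict (case p of (i, f) \<Rightarrow> f(c := i)) C) = p"
      using p assms(3) by (auto simp: fun_eq_iff restrict_def extensional_def)
    have "bij_betw (f(c := i)) (insert c C) (insert i (R - {i}))"
      using p assms(3) by (auto simp: bij_betw_def inj_on_def)
    then show "(case p of (i, f) \<Rightarrow> f(c := i)) \<in> ?F (insert c C) R"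
      using p by (auto simp: insert_absorb extensional_def)
    have "(\<Prod>j\<in>C. B ((f(c := i)) j) j) = (\<Prod>j\<in>C. B (f j) j)"
      by (rule prod.cong) (use assms(3) in auto)
    then show "(\<Prod>j\<in>insert c C. B ((case p of (i, f) \<Rightarrow> f(c := i)) j) j)
        = (case p of (i, f) \<Rightarrow> B i c * (\<Prod>j\<in>C. B (f j) j))"
      using p assms by simp
  next
    fix f assume "f \<in> ?F (insert c C) R"
    then have f: "f \<in> extensional (insert c C)" "inj_on f (insert c C)" "f ` insert c C = R"
      by (auto simp: bij_betw_def)
    show "(case (f c, restrict f C) of (i, f) \<Rightarrow> f(c := i)) = f"
      using f(1) by (auto simp: fun_eq_iff extensional_def)
    have "f c \<notin> f ` C" using f(2) assms(3) by (simp add: inj_on_insert)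
    then show "(f c, restrict f C) \<in> Sigma R (\<lambda>i. ?F C (R - {i}))"
      using f by (auto simp: bij_betw_def inj_on_insert image_iff)
  qed
  finally show ?thesis ..
qed

text \<open>A bijection meets every row once, so each summand contains every row factor once. The
  factors enter by multiplication, so \<open>s i = 0\<close> is allowed.\<close>

lemma perm_on_scale:
  assumes "\<And>i j. i \<in> R \<Longrightarrow> j \<in> C \<Longrightarrow> B i j = s i * A i j"
  shows "perm_on C R B = (\<Prod>i\<in>R. s i) * perm_on C R A"
  unfolding perm_on_def sum_distrib_left
proof (rule sum.cong)
  fix f assume "f \<in> {f. f \<in> extensional C \<and> bij_betw f C R}"
  then have f: "bij_betw f C R" by simp
  have "(\<Prod>j\<in>C. B (f j) j) = (\<Prod>j\<in>C. s (f j) * A (f j) j)"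
    using assms bij_betwE[OF f] by (intro prod.cong) auto
  also have "\<dots> = (\<Prod>i\<in>R. s i) * (\<Prod>j\<in>C. A (f j) j)"
    using prod.reindex_bij_betw[OF f, of s] by (simp add: prod.distrib)
  finally show "(\<Prod>j\<in>C. B (f j) j) = (\<Prod>i\<in>R. s i) * (\<Prod>j\<in>C. A (f j) j)" .
qed simp

text \<open>\<open>per\<close> sums over maps from rows to columns, so permutations are matched with
  their inverses, restricted in one direction and extended by the identity in the other.\<close>

lemma per_eq_perm_on: "per n B = perm_on {..<n} {..<n} B"
  unfolding per_def perm_on_def
proof (rule sum.reindex_bij_witness[where j = "\<lambda>p. restrict (inv p) {..<n}"
      and i = "\<lambda>f. inv (\<lambda>x. if x < n then f x else x)"])
  fix p assume "p \<in> {p. p permutes {..<n}}"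
  then have p: "p permutes {..<n}" by simp
  have ip: "inv p permutes {..<n}" using p by (rule permutes_inv)
  have "(\<lambda>x. if x < n then restrict (inv p) {..<n} x else x) = inv p"
    using ip by (auto simp: fun_eq_iff permutes_def)
  then show "inv (\<lambda>x. if x < n then restrict (inv p) {..<n} x else x) = p"
    using permutes_bij[OF p] by (simp add: inv_inv_eq)
  have "bij_betw (restrict (inv p) {..<n}) {..<n} {..<n}"
    using permutes_imp_bij[OF ip] by (rule bij_betw_cong[THEN iffD1, rotated]) simp
  then show "restrict (inv p) {..<n} \<in> {f. f \<in> extensional {..<n} \<and> bij_betw f {..<n} {..<n}}"
    by blast
  have "(\<Prod>j<n. B (inv p j) j) = (\<Prod>i<n. B (inv p (p i)) (p i))"
    using prod.reindex_bij_betw[OF permutes_imp_bij[OF p], of "\<lambda>j. B (inv p j) j"] by simp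
  then show "(\<Prod>j<n. B (restrict (inv p) {..<n} j) j) = (\<Prod>i<n. B i (p i))"
    using permutes_inverses[OF p] by simp
next
  fix f assume "f \<in> {f. f \<in> extensional {..<n} \<and> bij_betw f {..<n} {..<n}}"
  then have f: "f \<in> extensional {..<n}" "bij_betw f {..<n} {..<n}" by auto
  let ?q = "\<lambda>x. if x < n then f x else x"
  have "bij_betw ?q {..<n} {..<n}"
    using f(2) by (rule bij_betw_cong[THEN iffD1, rotated]) simp
  then have q: "?q permutes {..<n}" by (rule bij_imp_permutes) simp
  show "inv ?q \<in> {p. p permutes {..<n}}" using permutes_inv[OF q] by simp
  show "restrict (inv (inv ?q)) {..<n} = f"
    using permutes_bij[OF q] f(1) by (auto simp: inv_inv_eq fun_eq_iff extensional_def)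
qed

section \<open>Scalar estimates for the gauge function\<close>

text \<open>Interface between analysis and combinatorics: \<open>le_self\<close> will come from
  convexity, \<open>supermult\<close> from condition (1), and \<open>curve\<close> is condition
  (3).\<close>

locale permanent_gauge =
  fixes \<psi> :: "real \<Rightarrow> real"
  assumes cont: "continuous_on {0..1} \<psi>"
    and incr: "strict_mono_on {0..1} \<psi>"
    and zero: "\<psi> 0 = 0"
    and one: "\<psi> 1 = 1"
    and le_self: "\<And>x. x \<in> {0..1} \<Longrightarrow> \<psi> x \<le> x"
    and supermult: "\<And>u v. u \<in> {0..1} \<Longrightarrow> v \<in> {0..1} \<Longrightarrow> \<psi> u * \<psi> v \<le> \<psi> (u * v)"
    and curve: "\<And>r. r \<in> {0..1} \<Longrightarrow>
      \<psi> (exp (- r / exp 1)) + \<psi> (r * exp (- r / exp 1)) \<ge> 1"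
begin

lemma le_iff: "x \<in> {0..1} \<Longrightarrow> y \<in> {0..1} \<Longrightarrow> \<psi> x \<le> \<psi> y \<longleftrightarrow> x \<le> y"
  using strict_mono_on_less_eq[OF incr] by blast

lemma bounds:
  assumes "x \<in> {0..1}"
  shows "0 \<le> \<psi> x" "\<psi> x \<le> 1"
  using le_iff[of 0 x] le_iff[of x 1] assms zero one by auto

lemma complement_exists:
  assumes "x \<in> {0..1}"
  shows "\<exists>g\<in>{0..1}. \<psi> x + \<psi> g = 1"
  using IVT'[of \<psi> 0 "1 - \<psi> x" 1] bounds[OF assms] zero one cont by force

text \<open>For \<open>r > 1\<close>, the curve point with parameter \<open>\<rho> = r - e ln r\<close>, which lies in \<open>[0,1]\<close>, has the larger
  coordinate \<open>r exp (-r/e)\<close>, and its smaller one is at most \<open>exp (-r/e)\<close> because \<open>\<rho> r \<le> 1\<close>.\<close>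
lemma curve_extended:
  assumes "0 \<le> r" "r \<le> exp 1"
  shows "\<psi> (exp (- r / exp 1)) + \<psi> (r * exp (- r / exp 1)) \<ge> 1"
proof (cases "r \<le> 1")
  case True
  then show ?thesis using curve assms by simp
next
  case False
  let ?e = "exp 1 :: real"
  define \<rho> where "\<rho> = r - ?e * ln r"
  have r: "r > 1" using False by simp
  have lnr: "0 \<le> ln r" "ln r \<le> 1"
    using r assms ln_le_cancel_iff[of r ?e] by auto
  \<comment> \<open>ln z <= z - 1 at z = r/e gives e ln r <= r.\<close>
  have "ln (r / ?e) \<le> r / ?e - 1"
    using r by (intro ln_le_minus_one) simp
  then have "0 \<le> \<rho>"
    using r by (simp add: \<rho>_def ln_div field_simps)
  have "r - 1 / r \<le> ?e * ln r"
    using sinh_chord[OF lnr] r by (simp add: exp_minus inverse_eq_divide)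
  then have \<rho>r: "\<rho> \<le> 1 / r" by (simp add: \<rho>_def)
  also have "\<dots> \<le> 1" using r by simp
  finally have \<rho>: "\<rho> \<in> {0..1}" using \<open>0 \<le> \<rho>\<close> by simp
  have "exp (- \<rho> / ?e) = exp (ln r + - r / ?e)"
    by (simp add: \<rho>_def field_simps)
  then have eq: "exp (- \<rho> / ?e) = r * exp (- r / ?e)"
    using r by (simp add: exp_diff exp_minus divide_inverse)
  have "\<rho> * r \<le> 1" using \<rho>r r by (simp add: field_simps)
  then have le: "\<rho> * exp (- \<rho> / ?e) \<le> exp (- r / ?e)"
    unfolding eq using mult_right_mono[of "\<rho> * r" 1 "exp (- r / ?e)"] by (simp add: mult.assoc)
  have "\<psi> (\<rho> * exp (- \<rho> / ?e)) \<le> \<psi> (exp (- r / ?e))"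
    using le \<rho> r by (subst le_iff) (auto intro: mult_le_one)
  then show ?thesis
    using curve[OF \<rho>] unfolding eq by simp
qed

text \<open>Choose r with y = exp (-r/e); the bound 1/e <= y means r <= e. The extended curve
  inequality then gives \<open>\<psi> x \<le> \<psi> (r * y)\<close>, and monotonicity removes
  \<psi>.\<close>

lemma complement_le_entropy:
  assumes "x \<in> {0..1}" "y \<in> {0..1}" "\<psi> x + \<psi> y = 1" "exp (- 1) \<le> y"
  shows "x \<le> exp 1 * y * (- ln y)"
proof -
  let ?e = "exp 1 :: real"
  define r where "r = - ?e * ln y"
  have "0 < y" using assms(4) exp_gt_zero[of "- 1 :: real"] by linarith
  have "- 1 \<le> ln y"
    using assms(4) \<open>0 < y\<close> by (metis exp_gt_zero ln_exp ln_le_cancel_iff)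
  then have "0 \<le> r" "r \<le> ?e"
    using assms(2) \<open>0 < y\<close> mult_left_le[of "- ln y" ?e] by (auto simp: r_def mult_le_0_iff)
  moreover have ry: "exp (- r / ?e) = y"
    using \<open>0 < y\<close> by (simp add: r_def)
  ultimately have "1 \<le> \<psi> y + \<psi> (r * y)"
    using curve_extended by metis
  then have *: "\<psi> x \<le> \<psi> (r * y)" using assms(3) by simp
  \<comment> \<open>Keeps \<open>r * y\<close> inside [0,1], where \<psi> is known to be
    monotone.\<close>
  have "ln (1 / (?e * y)) \<le> 1 / (?e * y) - 1"
    using \<open>0 < y\<close> by (intro ln_le_minus_one) simp
  then have "r * y \<le> 1"
    using \<open>0 < y\<close> by (simp add: r_def ln_div ln_mult field_simps)
  then have "x \<le> r * y"
    using * assms(1,2) \<open>0 \<le> r\<close> by (subst (asm) le_iff) auto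
  then show ?thesis by (simp add: r_def mult_ac)
qed

text \<open>Split at y = 1/e. Below, x <= 1, e y <= 1 and 1 + U <= exp U suffice; above, the entropy
  bound reduces the left side to e y (U - ln y).\<close>

lemma pair_bound:
  assumes "x \<in> {0..1}" "y \<in> {0..1}" "\<psi> x + \<psi> y = 1" "0 \<le> U"
  shows "x + exp 1 * y * U \<le> exp U"
proof (cases "exp 1 * y \<le> 1")
  case True
  then have "x + exp 1 * y * U \<le> 1 + U"
    using assms mult_right_mono[of "exp 1 * y" 1 U] by auto
  then show ?thesis using exp_ge_add_one_self[of U] by linarith
next
  case False
  then have "exp (- 1) \<le> y" by (simp add: exp_minus field_simps)
  then have x: "x \<le> exp 1 * y * (- ln y)" and "0 < y"
    using complement_le_entropy assms exp_gt_zero[of "- 1 :: real"] by (blast, linarith)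
  \<comment> \<open>tangent line of \<open>exp\<close> at the point \<open>1 + ln y\<close>, where its slope is \<open>e y\<close>\<close>
  have "exp 1 * y * (U - ln y) \<le> exp 1 * y * exp (U - 1 - ln y)"
    using exp_ge_add_one_self[of "U - 1 - ln y"] \<open>0 < y\<close> by (intro mult_left_mono) auto
  also have "\<dots> = exp U"
    using \<open>0 < y\<close> by (simp add: exp_diff)
  finally show ?thesis using x by (simp add: algebra_simps)
qed

section \<open>Estimates for one column and for truncated rows\<close>

lemma column_bound:
  assumes R: "finite R" "i0 \<in> R"
    and x: "\<And>i. i \<in> R \<Longrightarrow> x i \<in> {0..1}"
    and g: "\<And>i. i \<in> R \<Longrightarrow> g i \<in> {0..1}"
    and xg: "\<And>i. i \<in> R \<Longrightarrow> \<psi> (x i) + \<psi> (g i) = 1"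
    and small: "\<And>i. i \<in> R - {i0} \<Longrightarrow> \<psi> (x i) \<le> 1 / 2"
  shows "(\<Sum>i\<in>R. x i * (\<Prod>k\<in>R - {i}. g k)) \<le> 1"
proof -
  define S where "S = R - {i0}"
  define U where "U = (\<Sum>i\<in>S. - ln (g i))"
  have S: "finite S" "i0 \<notin> S" "R = insert i0 S" using R by (auto simp: S_def)
  \<comment> \<open>Since \<open>\<psi> (g i) \<ge> 1/2\<close> and \<psi> lies below the identity,
    \<open>g i\<close> exceeds the threshold 1/e of the entropy bound. For \<open>i0\<close> this
    can fail, which is why \<open>pair_bound\<close> treats that row.\<close>
  have half: "1 / 2 \<le> g i" if "i \<in> S" for i
    using le_self[OF g[of i]] small[of i] xg[of i] that by (auto simp: S_def)
  have gpos: "0 < g i" if "i \<in> S" for i using half[OF that] by simp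
  have "exp (- 1) \<le> (1 / 2 :: real)"
    using exp_ge_add_one_self[of "1::real"] by (simp add: exp_minus field_simps)
  then have ent: "x i \<le> exp 1 * g i * (- ln (g i))" if "i \<in> S" for i
    using that S x g xg half[OF that] by (intro complement_le_entropy) auto
  have "0 \<le> U"
    unfolding U_def using g gpos S by (intro sum_nonneg) auto
  have P: "(\<Prod>i\<in>S. g i) = exp (- U)"
    unfolding U_def using S gpos by (simp add: sum_negf exp_sum)
  \<comment> \<open>The entropy bound for \<open>x i\<close> supplies the factor \<open>g i\<close>
    missing from the product, so all summands share the full product over \<open>S\<close>.\<close>
  have "(\<Sum>i\<in>S. x i * (\<Prod>k\<in>R - {i}. g k))
      \<le> (\<Sum>i\<in>S. g i0 * exp 1 * (- ln (g i)) * (\<Prod>k\<in>S. g k))"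
  proof (rule sum_mono)
    fix i assume i: "i \<in> S"
    have "R - {i} = insert i0 (S - {i})" using S i by auto
    then have "x i * (\<Prod>k\<in>R - {i}. g k) = x i * (g i0 * (\<Prod>k\<in>S - {i}. g k))"
      using S by simp
    also have "\<dots> \<le> exp 1 * g i * (- ln (g i)) * (g i0 * (\<Prod>k\<in>S - {i}. g k))"
      using ent[OF i] g S by (intro mult_right_mono mult_nonneg_nonneg prod_nonneg) auto
    also have "\<dots> = g i0 * exp 1 * (- ln (g i)) * (\<Prod>k\<in>S. g k)"
      using prod.remove[OF S(1) i, of g] by (simp add: mult_ac)
    finally show "x i * (\<Prod>k\<in>R - {i}. g k) \<le> g i0 * exp 1 * (- ln (g i)) * (\<Prod>k\<in>S. g k)" .
  qed
  also have "\<dots> = exp 1 * g i0 * U * exp (- U)"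
    unfolding P U_def sum_distrib_left sum_distrib_right by (simp add: mult_ac)
  finally have "(\<Sum>i\<in>R. x i * (\<Prod>k\<in>R - {i}. g k)) \<le> (x i0 + exp 1 * g i0 * U) * exp (- U)"
    using S P by (simp add: algebra_simps)
  also have "\<dots> \<le> exp U * exp (- U)"
    using R x g xg \<open>0 \<le> U\<close> by (intro mult_right_mono pair_bound) auto
  finally show ?thesis by (simp add: exp_minus)
qed

text \<open>The remaining \<psi>-mass of the row is at most \<open>\<psi> g\<close>;
  supermultiplicativity at \<open>v j / g\<close> and \<open>g\<close> lets one divide it by
  \<open>\<psi> g\<close>.\<close>

lemma truncated_row:
  assumes C: "finite C" "c \<notin> C"
    and v: "\<And>j. j \<in> insert c C \<Longrightarrow> v j \<in> {0..1}"
    and sum: "(\<Sum>j\<in>insert c C. \<psi> (v j)) \<le> 1"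
    and g: "g \<in> {0..1}" "\<psi> (v c) + \<psi> g = 1"
  shows "\<And>j. j \<in> C \<Longrightarrow> v j \<le> g" "(\<Sum>j\<in>C. \<psi> (v j / g)) \<le> 1"
proof -
  have sum': "(\<Sum>j\<in>C. \<psi> (v j)) \<le> \<psi> g" using C sum g by simp
  show le: "v j \<le> g" if "j \<in> C" for j
  proof -
    have "\<psi> (v j) \<le> (\<Sum>j\<in>C. \<psi> (v j))"
      using that C v bounds by (intro member_le_sum) auto
    then show ?thesis using sum' le_iff[of "v j" g] v g that by auto
  qed
  show "(\<Sum>j\<in>C. \<psi> (v j / g)) \<le> 1"
  proof (cases "g = 0")
    \<comment> \<open>Division by zero yields 0, so every summand is
      \<open>\<psi> 0 = 0\<close>.\<close>
    case True
    then show ?thesis by (simp add: zero)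
  next
    case False
    then have "0 < \<psi> g" using strict_mono_onD[OF incr, of 0 g] g zero by auto
    have "(\<Sum>j\<in>C. \<psi> (v j / g)) * \<psi> g \<le> (\<Sum>j\<in>C. \<psi> (v j))"
      unfolding sum_distrib_right
    proof (rule sum_mono)
      fix j assume j: "j \<in> C"
      have "\<psi> (v j / g) * \<psi> g \<le> \<psi> (v j / g * g)"
        using j le[OF j] v[of j] g False by (intro supermult) auto
      then show "\<psi> (v j / g) * \<psi> g \<le> \<psi> (v j)" using False by simp
    qed
    then show ?thesis using sum' \<open>0 < \<psi> g\<close> mult_right_le_imp_le[of "\<Sum>j\<in>C. \<psi> (v j / g)" "\<psi> g" 1] by linarith
  qed
qed

text \<open>Double counting of the entries with \<psi> > 1/2: two in one row would make its sum
  exceed 1, while two in every column would give 2 |C| <= |R| = |C|.\<close>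

lemma exists_good_column:
  assumes "finite C" "finite R" "card C = card R" "C \<noteq> {}"
    and B: "\<And>i j. i \<in> R \<Longrightarrow> j \<in> C \<Longrightarrow> B i j \<in> {0..1}"
    and row: "\<And>i. i \<in> R \<Longrightarrow> (\<Sum>j\<in>C. \<psi> (B i j)) \<le> 1"
  shows "\<exists>c\<in>C. \<exists>i0\<in>R. \<forall>i\<in>R - {i0}. \<psi> (B i c) \<le> 1 / 2"
proof -
  let ?L = "\<lambda>i j. 1 / 2 < \<psi> (B i j)"
  have one_large: "card {j\<in>C. ?L i j} \<le> 1" if i: "i \<in> R" for i
  proof (rule ccontr)
    assume "\<not> ?thesis"
    then have "1 < card {j\<in>C. ?L i j}" by simp
    have "1 < (\<Sum>j\<in>{j\<in>C. ?L i j}. \<psi> (B i j))"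
    proof -
      have "(\<Sum>j\<in>{j\<in>C. ?L i j}. 1 / 2) < (\<Sum>j\<in>{j\<in>C. ?L i j}. \<psi> (B i j))"
        using \<open>1 < card _\<close> assms(1)
        by (intro sum_strict_mono finite_subset[OF _ assms(1)]) (auto simp del: Collect_empty_eq)
      then show ?thesis using \<open>1 < card _\<close> by simp
    qed
    also have "\<dots> \<le> (\<Sum>j\<in>C. \<psi> (B i j))"
      using assms(1) B[OF i] bounds by (intro sum_mono2) auto
    finally show False using row[OF i] by simp
  qed
  have "\<exists>c\<in>C. card {i\<in>R. ?L i c} \<le> 1"
  proof (rule ccontr)
    assume "\<not> ?thesis"
    then have "(\<Sum>c\<in>C. 2) \<le> (\<Sum>c\<in>C. card {i\<in>R. ?L i c})"
      by (intro sum_mono) force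
    also have "\<dots> = (\<Sum>i\<in>R. card {j\<in>C. ?L i j})"
      using assms(1,2) by (intro sum_multicount_gen) auto
    also have "\<dots> \<le> (\<Sum>i\<in>R. 1)" by (intro sum_mono one_large)
    finally show False using assms by simp
  qed
  then obtain c where c: "c \<in> C" "card {i\<in>R. ?L i c} \<le> 1" by blast
  \<comment> \<open>If the column has no large entry, any row can serve as
    \<open>i0\<close>.\<close>
  have "R \<noteq> {}" using assms by auto
  moreover have "i = k" if "i \<in> R" "?L i c" "k \<in> R" "?L k c" for i k
    using c(2) assms(2) that card_le_Suc0_iff_eq[of "{i\<in>R. ?L i c}"] by simp
  ultimately obtain i0 where "i0 \<in> R" "\<And>i. i \<in> R \<Longrightarrow> ?L i c \<Longrightarrow> i = i0"
    by blast
  then have "\<forall>i\<in>R - {i0}. \<not> ?L i c" by blast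
  then have "\<forall>i\<in>R - {i0}. \<psi> (B i c) \<le> 1 / 2" by (simp add: not_less)
  then show ?thesis using c(1) \<open>i0 \<in> R\<close> by blast
qed

section \<open>Induction on the size of the matrix\<close>

text \<open>The induction varies \<open>C\<close>, \<open>R\<close> and \<open>B\<close> together,
  because each minor has its own index sets and its rows are divided by the
  \<open>g k\<close>.\<close>

theorem perm_on_le_1:
  assumes "finite C" "finite R" "card C = card R"
    and "\<And>i j. i \<in> R \<Longrightarrow> j \<in> C \<Longrightarrow> B i j \<in> {0..1}"
    and "\<And>i. i \<in> R \<Longrightarrow> (\<Sum>j\<in>C. \<psi> (B i j)) \<le> 1"
  shows "perm_on C R B \<le> 1"
  using assms
proof (induction "card C" arbitrary: C R B)
  case 0
  then have "C = {}" "R = {}"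
    using card_0_eq[OF "0.prems"(1)] card_0_eq[OF "0.prems"(2)] by metis+
  then show ?case by simp
next
  case (Suc m)
  have "C \<noteq> {}" using Suc.hyps(2) by (metis card.empty nat.distinct(1))
  have "\<exists>c\<in>C. \<exists>i0\<in>R. \<forall>i\<in>R - {i0}. \<psi> (B i c) \<le> 1 / 2"
    by (rule exists_good_column) (fact Suc.prems \<open>C \<noteq> {}\<close>)+
  then obtain c i0 where c: "c \<in> C" "i0 \<in> R" "\<forall>i\<in>R - {i0}. \<psi> (B i c) \<le> 1 / 2"
    by blast
  define D where "D = C - {c}"
  have D: "C = insert c D" "c \<notin> D" "finite D" using c(1) Suc.prems(1) by (auto simp: D_def)
  have "\<exists>g\<in>{0..1}. \<psi> (B i c) + \<psi> g = 1" if "i \<in> R" for i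
    using Suc.prems(4)[OF that c(1)] by (rule complement_exists)
  then obtain g
    where g: "\<And>i. i \<in> R \<Longrightarrow> g i \<in> {0..1}" "\<And>i. i \<in> R \<Longrightarrow> \<psi> (B i c) + \<psi> (g i) = 1"
    unfolding Bex_def by metis
  have trunc: "\<And>j. j \<in> D \<Longrightarrow> B i j \<le> g i" "(\<Sum>j\<in>D. \<psi> (B i j / g i)) \<le> 1" if "i \<in> R" for i
  proof -
    have v: "\<And>j. j \<in> insert c D \<Longrightarrow> B i j \<in> {0..1}" "(\<Sum>j\<in>insert c D. \<psi> (B i j)) \<le> 1"
      unfolding D(1)[symmetric] by (fact Suc.prems(4,5)[OF \<open>i \<in> R\<close>])+
    note row = truncated_row[of D c "B i" "g i", OF D(3,2)]
    show "B i j \<le> g i" if "j \<in> D" for j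
      by (rule row(1)) (fact v g[OF \<open>i \<in> R\<close>] that)+
    show "(\<Sum>j\<in>D. \<psi> (B i j / g i)) \<le> 1"
      by (rule row(2)) (fact v g[OF \<open>i \<in> R\<close>])+
  qed
  have B01: "0 \<le> B i j" "B i j \<le> 1" if "i \<in> R" "j \<in> D" for i j
    using Suc.prems(4)[of i j] that by (simp_all add: D_def)
  have minor: "perm_on D (R - {i}) B \<le> (\<Prod>k\<in>R - {i}. g k)" if i: "i \<in> R" for i
  proof -
    have "perm_on D (R - {i}) B
        = (\<Prod>k\<in>R - {i}. g k) * perm_on D (R - {i}) (\<lambda>k j. B k j / g k)"
    proof (rule perm_on_scale)
      \<comment> \<open>If \<open>g k = 0\<close>, truncation forces the rest of row
        \<open>k\<close> to vanish, so the identity survives the division by zero.\<close>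
      fix k j assume "k \<in> R - {i}" "j \<in> D"
      then show "B k j = g k * (B k j / g k)"
        using trunc(1)[of k j] B01[of k j] by (cases "g k = 0") auto
    qed
    moreover have "perm_on D (R - {i}) (\<lambda>k j. B k j / g k) \<le> 1"
    proof (rule Suc.hyps(1))
      show "m = card D" "card D = card (R - {i})"
        using Suc.hyps(2)[symmetric] Suc.prems(1-3) c(1) i by (simp_all add: D_def)
      show "B k j / g k \<in> {0..1}" if "k \<in> R - {i}" "j \<in> D" for k j
        using trunc(1)[of k j] B01[of k j] g(1)[of k] that
        by (cases "g k = 0") auto
    qed (use D(3) Suc.prems(2) trunc(2) in auto)
    moreover have "0 \<le> (\<Prod>k\<in>R - {i}. g k)" using g by (intro prod_nonneg) auto
    ultimately show ?thesis by (simp add: mult_left_le)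
  qed
  have "perm_on C R B = (\<Sum>i\<in>R. B i c * perm_on D (R - {i}) B)"
    unfolding D(1) using D(3) Suc.prems(2) D(2) by (rule perm_on_insert)
  also have "\<dots> \<le> (\<Sum>i\<in>R. B i c * (\<Prod>k\<in>R - {i}. g k))"
    using minor Suc.prems(4)[OF _ c(1)] by (intro sum_mono mult_left_mono) auto
  also have "\<dots> \<le> 1"
    using Suc.prems(2) c(2) Suc.prems(4)[OF _ c(1)] g bspec[OF c(3)] by (rule column_bound)
  finally show ?case .
qed

section \<open>The Orlicz norm and row normalisation\<close>

text \<open>The definite description is meaningful because \<open>F\<close> is continuous and
  strictly decreasing from the largest entry \<open>M\<close> onwards and takes the value 1 between
  \<open>M\<close> and \<open>n * M\<close>.\<close>

lemma orlicz_norm_props: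
  assumes v: "\<And>i. i < n \<Longrightarrow> 0 \<le> v i" and nz: "\<exists>i<n. v i \<noteq> 0"
  defines "s \<equiv> orlicz_norm \<psi> n v"
  shows "s > 0" "\<And>i. i < n \<Longrightarrow> v i \<le> s" "(\<Sum>i<n. \<psi> (v i / s)) = 1"
proof -
  define F where "F s = (\<Sum>i<n. \<psi> (v i / s))" for s
  define M where "M = Max (v ` {..<n})"
  let ?Q = "\<lambda>s. s > 0 \<and> (\<forall>i<n. \<bar>v i\<bar> \<le> s) \<and> (\<Sum>i<n. \<psi> (\<bar>v i\<bar> / s)) = 1"
  obtain k where k: "k < n" "v k \<noteq> 0" using nz by blast
  have vM: "v i \<le> M" if "i < n" for i using that by (simp add: M_def)
  have "M \<in> v ` {..<n}" unfolding M_def using k by (intro Max_in) auto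
  then obtain m where m: "m < n" "v m = M" by auto
  have M: "M > 0" using vM[of k] v[of k] k by simp
  have frac: "v i / t \<in> {0..1}" if "i < n" "M \<le> t" for i t
    using vM[OF that(1)] v[OF that(1)] M that by auto
  have cont: "continuous_on {M..real n * M} F"
    unfolding F_def using M frac
    by (intro continuous_on_sum continuous_on_compose2[OF cont] continuous_intros) auto
  have "1 = \<psi> (v m / M)" using m M one by simp
  also have "\<dots> \<le> F M" unfolding F_def
    using m bounds frac by (intro member_le_sum) auto
  finally have lo: "1 \<le> F M" .
  have nM: "M \<le> real n * M" using M k by simp
  \<comment> \<open>At scale \<open>n * M\<close> each argument is at most 1/n, and
    \<open>le_self\<close> bounds each summand by the same amount.\<close>
  have "F (real n * M) \<le> (\<Sum>i<n. 1 / real n)"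
    unfolding F_def
  proof (rule sum_mono)
    fix i assume "i \<in> {..<n}"
    then have i: "i < n" by simp
    have "\<psi> (v i / (real n * M)) \<le> v i / (real n * M)"
      using le_self frac[OF i nM] by blast
    also have "\<dots> \<le> 1 / real n" using vM[OF i] M i by (simp add: field_simps)
    finally show "\<psi> (v i / (real n * M)) \<le> 1 / real n" .
  qed
  also have "\<dots> = 1" using k by simp
  finally obtain t where t: "M \<le> t" "F t = 1"
    using IVT2'[of F "real n * M" 1 M] lo nM cont by blast
  have anti: "F b < F a" if ab: "M \<le> a" "a < b" for a b
    unfolding F_def
  proof (rule sum_strict_mono_ex1)
    show "\<forall>i\<in>{..<n}. \<psi> (v i / b) \<le> \<psi> (v i / a)"
    proof
      fix i assume i: "i \<in> {..<n}"
      have "v i / b \<le> v i / a" using ab M v i by (intro divide_left_mono) auto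
      then show "\<psi> (v i / b) \<le> \<psi> (v i / a)" using le_iff frac ab i by auto
    qed
    have "v m / b < v m / a" using ab M m by (intro divide_strict_left_mono) auto
    then have "\<psi> (v m / b) < \<psi> (v m / a)"
      using strict_mono_onD[OF incr] frac ab m by auto
    then show "\<exists>i\<in>{..<n}. \<psi> (v i / b) < \<psi> (v i / a)" using m by blast
  qed simp
  have Q: "?Q s \<longleftrightarrow> M \<le> s \<and> F s = 1" for s
  proof -
    have "(\<forall>i<n. \<bar>v i\<bar> \<le> s) \<longleftrightarrow> M \<le> s"
      using m v vM by (metis abs_of_nonneg order_trans)
    moreover have "(\<Sum>i<n. \<psi> (\<bar>v i\<bar> / s)) = F s"
      unfolding F_def using v by (intro sum.cong) auto
    ultimately show ?thesis using M by auto
  qed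
  have "\<exists>!s. ?Q s"
  proof
    show "?Q t" unfolding Q using t by simp
    show "s = t" if "?Q s" for s
      using that anti t unfolding Q by (metis less_irrefl linorder_neqE_linordered_idom)
  qed
  then have "?Q (THE s. ?Q s)" by (rule theI')
  moreover have "s = (THE s. ?Q s)" unfolding s_def orlicz_norm_def using nz by auto
  ultimately have "M \<le> s" "F s = 1" using Q by auto
  then show "s > 0" "\<And>i. i < n \<Longrightarrow> v i \<le> s" "(\<Sum>i<n. \<psi> (v i / s)) = 1"
    using M vM by (auto simp: F_def intro: order_trans)
qed

text \<open>Dividing each row by its norm reduces to \<open>perm_on_le_1\<close>. A zero row has
  norm 0 and is split off; both sides then vanish.\<close>

theorem per_le_prod_orlicz_norm:
  assumes B: "\<And>i j. i < n \<Longrightarrow> j < n \<Longrightarrow> 0 \<le> B i j"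
  shows "per n B \<le> (\<Prod>i<n. orlicz_norm \<psi> n (B i))"
proof (cases "\<exists>i<n. \<forall>j<n. B i j = 0")
  case True
  then obtain i where i: "i < n" "\<And>j. j < n \<Longrightarrow> B i j = 0" by blast
  have "(\<Prod>k<n. B k (p k)) = 0" if "p permutes {..<n}" for p
    using i permutes_in_image[OF that, of i] by (intro prod_zero) auto
  then have "per n B = 0" unfolding per_def by (intro sum.neutral) blast
  moreover have "orlicz_norm \<psi> n (B i) = 0" using i by (simp add: orlicz_norm_def)
  then have "(\<Prod>i<n. orlicz_norm \<psi> n (B i)) = 0" using i(1) by (intro prod_zero) auto
  ultimately show ?thesis by linarith
next
  case False
  let ?s = "\<lambda>i. orlicz_norm \<psi> n (B i)"
  have s: "?s i > 0" "\<And>j. j < n \<Longrightarrow> B i j \<le> ?s i" "(\<Sum>j<n. \<psi> (B i j / ?s i)) = 1" if "i < n" for i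
  proof -
    have nz: "\<exists>j<n. B i j \<noteq> 0" using False that by blast
    show "?s i > 0" "\<And>j. j < n \<Longrightarrow> B i j \<le> ?s i" "(\<Sum>j<n. \<psi> (B i j / ?s i)) = 1"
      using orlicz_norm_props[OF B[OF that] nz] by auto
  qed
  have "per n B = (\<Prod>i<n. ?s i) * perm_on {..<n} {..<n} (\<lambda>i j. B i j / ?s i)"
    unfolding per_eq_perm_on by (rule perm_on_scale) (use s(1) in force)
  moreover have "perm_on {..<n} {..<n} (\<lambda>i j. B i j / ?s i) \<le> 1"
    using B s by (intro perm_on_le_1) (auto simp: less_imp_le)
  moreover have "0 \<le> (\<Prod>i<n. ?s i)" using s(1) by (intro prod_nonneg) (auto simp: less_imp_le)
  ultimately show ?thesis by (simp add: mult_left_le)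
qed

end

section \<open>From the analytic hypotheses to the gauge properties\<close>

text \<open>For fixed u > 0 the quotient \<open>\<psi> (u * t) / \<psi> t\<close> is nonincreasing:
  t times its logarithmic derivative is the elasticity at \<open>u * t\<close> minus that at
  \<open>t\<close>. Compare its values at \<open>v\<close> and 1.\<close>

lemma supermultiplicative_of_elasticity_mono:
  fixes \<psi> \<psi>' :: "real \<Rightarrow> real"
  assumes d: "\<And>x. x \<in> {0..1} \<Longrightarrow> (\<psi> has_real_derivative \<psi>' x) (at x within {0..1})"
    and pos: "\<And>x. x \<in> {0<..1} \<Longrightarrow> 0 < \<psi> x"
    and zero: "\<psi> 0 = 0" and one: "\<psi> 1 = 1"
    and elast: "mono_on {0<..1} (\<lambda>x. x * \<psi>' x / \<psi> x)"
    and u: "u \<in> {0..1}" and v: "v \<in> {0..1}"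
  shows "\<psi> u * \<psi> v \<le> \<psi> (u * v)"
proof (cases "u = 0 \<or> v = 0")
  case True
  then show ?thesis using zero by auto
next
  case False
  then have uv: "0 < u" "u \<le> 1" "0 < v" "v \<le> 1" using u v by auto
  have cont: "continuous_on {0..1} \<psi>"
    using d by (rule DERIV_continuous_on)
  have deriv: "(\<psi> has_real_derivative \<psi>' x) (at x)" if "0 < x" "x < 1" for x
    using d[of x] that at_within_interior[of x "{0..1}"] by auto
  have ut: "0 < u * t" "u * t \<le> 1" if "0 < t" "t \<le> 1" for t
    using uv that mult_le_one[of u t] by auto
  have "\<psi> (u * 1) / \<psi> 1 \<le> \<psi> (u * v) / \<psi> v"
  proof (rule DERIV_nonpos_imp_decreasing_open[where f = "\<lambda>t. \<psi> (u * t) / \<psi> t"])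
    fix t assume t: "v < t" "t < 1"
    then have t0: "0 < t" using uv by simp
    have ut1: "u * t < 1" using mult_right_mono[of u 1 t] uv t t0 by linarith
    have p: "0 < \<psi> t" "0 < \<psi> (u * t)" using pos t t0 ut[of t] by auto
    have "((\<lambda>t. \<psi> (u * t)) has_real_derivative \<psi>' (u * t) * u) (at t)"
      by (rule DERIV_chain'[of "(*) u", OF _ deriv])
        (use ut[of t] ut1 t t0 in \<open>auto intro!: derivative_eq_intros\<close>)
    then have "((\<lambda>t. \<psi> (u * t) / \<psi> t) has_real_derivative
        (\<psi>' (u * t) * u * \<psi> t - \<psi> (u * t) * \<psi>' t) / (\<psi> t * \<psi> t)) (at t)"
      using DERIV_divide[OF _ deriv[OF t0 t(2)]] p by force
    moreover have "u * t * \<psi>' (u * t) / \<psi> (u * t) \<le> t * \<psi>' t / \<psi> t"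
      using uv t t0 ut[of t] mult_right_mono[of u 1 t] by (intro mono_onD[OF elast]) auto
    then have "t * (\<psi>' (u * t) * u * \<psi> t) \<le> t * (\<psi> (u * t) * \<psi>' t)"
      using p by (simp add: field_simps)
    then have "(\<psi>' (u * t) * u * \<psi> t - \<psi> (u * t) * \<psi>' t) / (\<psi> t * \<psi> t) \<le> 0"
      using t0 by (intro divide_nonpos_nonneg) auto
    ultimately show "\<exists>y. ((\<lambda>t. \<psi> (u * t) / \<psi> t) has_real_derivative y) (at t) \<and> y \<le> 0" by blast
  next
    have "\<psi> t \<noteq> 0" if "t \<in> {v..1}" for t using pos[of t] that uv by auto
    then show "continuous_on {v..1} (\<lambda>t. \<psi> (u * t) / \<psi> t)"
      using uv ut by (intro continuous_on_divide continuous_on_compose2[OF cont] continuous_intros)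
        (auto simp: less_imp_le)
  qed (use uv in simp)
  then show ?thesis using pos[of v] uv one by (simp add: field_simps)
qed

theorem theorem4p1:
  fixes \<psi> \<psi>1 \<psi>2 \<psi>3 :: "real \<Rightarrow> real"
  assumes convex: "convex_on {0..1} \<psi>"
    and incr: "strict_mono_on {0..1} \<psi>"
    and surj: "\<psi> ` {0..1} = {0..1}"
    and d1: "\<And>x. x \<in> {0..1} \<Longrightarrow> (\<psi> has_real_derivative \<psi>1 x) (at x within {0..1})"
    and d2: "\<And>x. x \<in> {0..1} \<Longrightarrow> (\<psi>1 has_real_derivative \<psi>2 x) (at x within {0..1})"
    and d3: "\<And>x. x \<in> {0..1} \<Longrightarrow> (\<psi>2 has_real_derivative \<psi>3 x) (at x within {0..1})"
    and pos: "\<And>x. x \<in> {0<..1} \<Longrightarrow> \<psi>1 x > 0"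
    and cond1: "strict_mono_on {0<..1} (\<lambda>x. x * \<psi>1 x / \<psi> x)"
    and cond2: "strict_mono_on {0<..1} (\<lambda>x. x * \<psi>2 x / \<psi>1 x)"
    and cond3: "\<And>r. r \<in> {0..1} \<Longrightarrow>
                  \<psi> (exp (- r / exp 1)) + \<psi> (r * exp (- r / exp 1)) \<ge> 1"
    and n: "n \<ge> 1"
    and nonneg: "\<And>i j. i < n \<Longrightarrow> j < n \<Longrightarrow> B i j \<ge> 0"
  shows "per n B \<le> (\<Prod>i<n. orlicz_norm \<psi> n (\<lambda>j. B i j))"
proof -
  have le: "\<psi> x \<le> \<psi> y" if "x \<in> {0..1}" "y \<in> {0..1}" "x \<le> y" for x y
    using strict_mono_on_leD[OF incr] that by blast
  have range: "\<psi> x \<in> {0..1}" if "x \<in> {0..1}" for x using surj that by blast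
  have "0 \<in> \<psi> ` {0..1}" "1 \<in> \<psi> ` {0..1}" using surj by auto
  then obtain a b where "a \<in> {0..1}" "\<psi> a = 0" "b \<in> {0..1}" "\<psi> b = 1"
    by (metis imageE)
  then have zero: "\<psi> 0 = 0" and one: "\<psi> 1 = 1"
    using le[of 0 a] le[of b 1] range[of 0] range[of 1] by auto
  interpret permanent_gauge \<psi>
  proof
    show "continuous_on {0..1} \<psi>"
      using d1 by (rule DERIV_continuous_on)
    \<comment> \<open>A convex function lies below its chord, here from (0,0) to (1,1).\<close>
    show "\<psi> x \<le> x" if "x \<in> {0..1}" for x
      using convex_onD[OF convex, of x 0 1] that zero one by simp
    show "\<psi> u * \<psi> v \<le> \<psi> (u * v)" if "u \<in> {0..1}" "v \<in> {0..1}" for u v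
    proof (rule supermultiplicative_of_elasticity_mono[OF d1 _ zero one _ that])
      show "0 < \<psi> x" if "x \<in> {0<..1}" for x
        using strict_mono_onD[OF incr, of 0 x] that zero by auto
      show "mono_on {0<..1} (\<lambda>x. x * \<psi>1 x / \<psi> x)"
        using cond1 by (rule strict_mono_on_imp_mono_on)
    qed
  qed (fact incr zero one cond3)+
  show ?thesis using nonneg by (rule per_le_prod_orlicz_norm)
qed

end
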